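(* Let $X,Y,E$ be real Banach spaces. For $(a,b)\in X\times Y$ and $T\in\operatorname{BLip}_0(X,Y;E)$ let $\rho_{(a,b)}(T)\in\operatorname{BLip}_0(X,Y;E)$ be given by $$(\rho_{(a,b)}(T))(x,y)=T(x+a,y+b)-T(x+a,b)-T(a,y+b)+T(a,b).$$ Then $$\operatorname{Fix}(\rho):=\{T\in\operatorname{BLip}_0(X,Y;E):\rho_{(a,b)}(T)=T\text{ for every }(a,b)\in X\times Y\}=\operatorname{Blin}(X,Y;E).$$
   Context: $\operatorname{BLip}_0(X,Y;E)$ is the Banach space of all mappings $T\colon X\times Y\to E$ such that $T(x,0)=T(0,y)=0$ for all $x\in X$, $y\in Y$, and for some $C\ge0$, $\|T(x,y)-T(x',y)-T(x,y')+T(x',y')\|\le C\|x-x'\|\|y-y'\|$ for all $x,x'\in X$, $y,y'\in Y$; its norm $\|T\|_{\operatorname{BLip}}$ is the least admissible $C$. $\operatorname{Blin}(X,Y;E)$ is the space of bounded bilinear mappings $X\times Y\to E$; it is contained in $\operatorname{BLip}_0(X,Y;E)$, with $\|B\|_{\operatorname{BLip}}=\|B\|$. *)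

theory Defs
  imports "HOL-Analysis.Analysis"
begin

text \<open>
  Mappings on a product of two spaces are curried, as in the library's
  \<^const>\<open>bounded_bilinear\<close>. The set \<open>BLip0\<close> consists of the two-Lipschitz mappings
  vanishing on both axes; its norm plays no role below and is not introduced.
\<close>

definition BLip0 :: "('a::real_normed_vector \<Rightarrow> 'b::real_normed_vector \<Rightarrow> 'c::real_normed_vector) set"
  where "BLip0 = {T. (\<forall>x. T x 0 = 0) \<and> (\<forall>y. T 0 y = 0) \<and>
    (\<exists>C\<ge>0. \<forall>x x' y y'.
      norm (T x y - T x' y - T x y' + T x' y') \<le> C * norm (x - x') * norm (y - y'))}"

definition Blin :: "('a::real_normed_vector \<Rightarrow> 'b::real_normed_vector \<Rightarrow> 'c::real_normed_vector) set"
  where "Blin = {B. bounded_bilinear B}"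

definition rho :: "'a::real_normed_vector \<times> 'b::real_normed_vector \<Rightarrow>
    ('a \<Rightarrow> 'b \<Rightarrow> 'c::real_normed_vector) \<Rightarrow> 'a \<Rightarrow> 'b \<Rightarrow> 'c"
  where "rho = (\<lambda>(a, b) T x y. T (x + a) (y + b) - T (x + a) b - T a (y + b) + T a b)"

lemma rho_in_BLip0:
  assumes "T \<in> BLip0"
  shows "rho p T \<in> BLip0"
proof -
  obtain a b where p: "p = (a, b)" by (cases p)
  obtain C where C: "C \<ge> 0"
    "\<And>x x' y y'. norm (T x y - T x' y - T x y' + T x' y') \<le> C * norm (x - x') * norm (y - y')"
    using assms unfolding BLip0_def by blast
  have "norm (rho p T x y - rho p T x' y - rho p T x y' + rho p T x' y')
      \<le> C * norm (x - x') * norm (y - y')" for x x' y y'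
    using C(2)[of "x + a" "y + b" "x' + a" "y' + b"] by (simp add: p rho_def algebra_simps)
  with C(1) show ?thesis
    unfolding BLip0_def by (auto simp: p rho_def)
qed

definition Fix :: "('p \<Rightarrow> ('a::real_normed_vector \<Rightarrow> 'b::real_normed_vector \<Rightarrow> 'c::real_normed_vector) \<Rightarrow>
    'a \<Rightarrow> 'b \<Rightarrow> 'c) \<Rightarrow> ('a \<Rightarrow> 'b \<Rightarrow> 'c) set"
  where "Fix \<sigma> = {T \<in> BLip0. \<forall>p. \<sigma> p T = T}"

end

theory Submission
  imports Defs
begin

text \<open>
  Evaluating \<open>\<rho>\<^bsub>(a,0)\<^esub>(T) = T\<close> at \<open>(x, y)\<close>, where the two terms with second argument \<open>0\<close> vanish,
  gives \<open>T (x + a) y = T x y + T a y\<close>; taking \<open>(0,b)\<close> instead gives additivity in the second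
  variable. The estimate defining \<open>BLip0\<close>, applied with \<open>x' = 0\<close> and \<open>y' = 0\<close>, is the bound
  \<open>\<parallel>T x y\<parallel> \<le> C * \<parallel>x\<parallel> * \<parallel>y\<parallel>\<close>. So all that separates a fixed point of \<open>\<rho>\<close> from a bounded
  bilinear mapping is real homogeneity, and an additive mapping with a linear bound has it
  (\<open>additive_bounded_imp_scaleR\<close>).

  Conversely, for bilinear \<open>T\<close> the mixed second difference
  \<open>T x y - T x' y - T x y' + T x' y'\<close> is \<open>T (x - x') (y - y')\<close>. This yields the two-Lipschitz
  estimate, and, since \<open>\<rho>\<^bsub>(a,b)\<^esub>(T)\<close> at \<open>(x, y)\<close> is the mixed difference between the points
  \<open>(x + a, y + b)\<close> and \<open>(a, b)\<close>, also the invariance.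
\<close>

lemma additive_scaleR_of_int:
  fixes f :: "'v::real_vector \<Rightarrow> 'w::real_vector"
  assumes "Modules.additive f"
  shows "f (real_of_int k *\<^sub>R x) = real_of_int k *\<^sub>R f x"
proof -
  interpret f: Modules.additive f by fact
  have nat: "f (real n *\<^sub>R x) = real n *\<^sub>R f x" for n
    by (induction n) (simp_all add: f.zero f.add scaleR_add_left)
  show ?thesis
    by (cases k) (simp_all only: of_int_of_nat_eq of_int_minus scaleR_minus_left nat f.minus)
qed

text \<open>
  A bound on the unit interval upgrades integral to real homogeneity: the defect
  \<open>f (r *\<^sub>R x) - r *\<^sub>R f x\<close> is additive in \<open>r\<close> and vanishes at integers, so it is periodic and hence
  bounded over all \<open>r\<close>; its multiples, being values of the defect at multiples of \<open>r\<close>, share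
  that bound, which forces it to be zero.
\<close>

lemma additive_bounded_imp_scaleR:
  fixes f :: "'v::real_normed_vector \<Rightarrow> 'w::real_normed_vector"
  assumes "Modules.additive f" and bound: "\<And>x. norm (f x) \<le> K * norm x"
  shows "f (r *\<^sub>R x) = r *\<^sub>R f x"
proof -
  interpret f: Modules.additive f by fact
  note int = additive_scaleR_of_int[OF \<open>Modules.additive f\<close>]
  have unit_interval: "norm (f (s *\<^sub>R x) - s *\<^sub>R f x) \<le> K * norm x + K * norm x"
    if s: "0 \<le> s" "s \<le> 1" for s
  proof -
    have nonneg: "0 \<le> K * norm x"
      using bound[of x] norm_ge_zero[of "f x"] by linarith
    have "norm (f (s *\<^sub>R x)) \<le> s * (K * norm x)"
      using bound[of "s *\<^sub>R x"] s by (simp add: mult.left_commute)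
    moreover have "norm (s *\<^sub>R f x) \<le> s * (K * norm x)"
      using bound[of x] s by (simp add: mult_left_mono)
    moreover have "s * (K * norm x) \<le> K * norm x"
      using nonneg s by (simp add: mult_left_le_one_le)
    ultimately show ?thesis
      using norm_triangle_ineq4[of "f (s *\<^sub>R x)" "s *\<^sub>R f x"] by linarith
  qed
  have "norm (f (r *\<^sub>R x) - r *\<^sub>R f x) = 0"
  proof (rule real_archimedian_rdiv_eq_0)
    fix m :: nat
    define s where "s = frac (real m * r)"
    have split: "real m * r = real_of_int \<lfloor>real m * r\<rfloor> + s"
      by (simp add: s_def frac_def)
    have "real m *\<^sub>R (f (r *\<^sub>R x) - r *\<^sub>R f x) = f ((real m * r) *\<^sub>R x) - (real m * r) *\<^sub>R f x"
      using int[of "int m" "r *\<^sub>R x"] by (simp add: scaleR_diff_right)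
    also have "\<dots> = f (s *\<^sub>R x) - s *\<^sub>R f x"
      by (subst (1 2) split) (simp only: scaleR_add_left f.add int add_diff_cancel_left)
    finally have "real m * norm (f (r *\<^sub>R x) - r *\<^sub>R f x) = norm (f (s *\<^sub>R x) - s *\<^sub>R f x)"
      by (metis abs_of_nat norm_scaleR)
    also have "\<dots> \<le> K * norm x + K * norm x"
      by (rule unit_interval) (simp_all add: s_def frac_lt_1 less_imp_le)
    finally show "real m * norm (f (r *\<^sub>R x) - r *\<^sub>R f x) \<le> K * norm x + K * norm x" .
  qed simp
  then show ?thesis by simp
qed

lemma bounded_bilinear_if_biadditive:
  assumes left: "\<And>x x' y. T (x + x') y = T x y + T x' y"
    and right: "\<And>x y y'. T x (y + y') = T x y + T x y'"
    and bound: "\<And>x y. norm (T x y) \<le> C * norm x * norm y"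
  shows "bounded_bilinear T"
proof
  show "T (r *\<^sub>R x) y = r *\<^sub>R T x y" for r x y
    using bound[of _ y]
    by (intro additive_bounded_imp_scaleR[where f = "\<lambda>x. T x y" and K = "C * norm y"])
      (simp_all add: Modules.additive_def left mult_ac)
  show "T x (r *\<^sub>R y) = r *\<^sub>R T x y" for r x y
    using bound[of x]
    by (intro additive_bounded_imp_scaleR[where f = "T x" and K = "C * norm x"])
      (simp_all add: Modules.additive_def right)
  show "\<exists>K. \<forall>x y. norm (T x y) \<le> norm x * norm y * K"
    using bound by (intro exI[of _ C]) (simp add: mult_ac)
qed (fact left right)+

lemma Fix_rho_subset_Blin: "Fix rho \<subseteq> Blin"
proof
  fix T :: "'a::real_normed_vector \<Rightarrow> 'b::real_normed_vector \<Rightarrow> 'c::real_normed_vector"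
  assume "T \<in> Fix rho"
  then have T: "T \<in> BLip0" and fixed: "\<And>a b. rho (a, b) T = T"
    by (simp_all add: Fix_def)
  from T obtain C where axes: "\<And>x. T x 0 = 0" "\<And>y. T 0 y = 0"
    and C: "\<And>x x' y y'. norm (T x y - T x' y - T x y' + T x' y')
      \<le> C * norm (x - x') * norm (y - y')"
    by (auto simp: BLip0_def)
  have shift: "T (x + a) (y + b) - T (x + a) b - T a (y + b) + T a b = T x y" for x y a b
    using fun_cong[OF fun_cong[OF fixed[of a b]], of x y] by (simp add: rho_def)
  have "bounded_bilinear T"
  proof (rule bounded_bilinear_if_biadditive)
    show "T (x + x') y = T x y + T x' y" for x x' y
      using shift[of x x' y 0] by (simp add: axes algebra_simps)
    show "T x (y + y') = T x y + T x y'" for x y y'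
      using shift[of x 0 y y'] by (simp add: axes algebra_simps)
    show "norm (T x y) \<le> C * norm x * norm y" for x y
      using C[of x y 0 0] by (simp add: axes)
  qed
  then show "T \<in> Blin" by (simp add: Blin_def)
qed

lemma (in bounded_bilinear) mixed_difference:
  "prod x y - prod x' y - prod x y' + prod x' y' = prod (x - x') (y - y')"
  by (simp add: diff_left diff_right)

lemma Blin_subset_Fix_rho: "Blin \<subseteq> Fix rho"
proof
  fix T :: "'a::real_normed_vector \<Rightarrow> 'b::real_normed_vector \<Rightarrow> 'c::real_normed_vector"
  assume "T \<in> Blin"
  then interpret T: bounded_bilinear T by (simp add: Blin_def)
  obtain K where K: "K \<ge> 0" "\<And>x y. norm (T x y) \<le> norm x * norm y * K"
    using T.nonneg_bounded by blast
  have "T \<in> BLip0"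
    unfolding BLip0_def mem_Collect_eq T.mixed_difference
    using K by (auto simp: T.zero_left T.zero_right mult_ac intro!: exI[of _ K])
  moreover have "rho (a, b) T = T" for a b
  proof (intro ext)
    fix x y
    have "rho (a, b) T x y = T (x + a) (y + b) - T a (y + b) - T (x + a) b + T a b"
      by (simp add: rho_def)
    then show "rho (a, b) T x y = T x y"
      by (simp add: T.mixed_difference)
  qed
  ultimately show "T \<in> Fix rho" by (auto simp: Fix_def)
qed

theorem theorem4p11:
  shows "Fix rho = (Blin :: ('a::banach \<Rightarrow> 'b::banach \<Rightarrow> 'c::banach) set)"
  using Fix_rho_subset_Blin Blin_subset_Fix_rho by (rule subset_antisym)

end
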